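(* Let $c_s=c_s(\varrho)>0$ be a smooth function and let $c_s'=\frac{d}{d\varrho}c_s$. Consider (smooth) solutions $\vec V=(\varrho,v^1,v^2,v^3,\varpi^1,\varpi^2,\varpi^3)$, on open subsets of spacetime with Cartesian coordinates $(t,x^1,x^2,x^3)$, of the system ($i=1,2,3$) $$\square_gv^i=-c_s^2e^{\varrho}(\operatorname{curl}\varpi)^i+2e^{\varrho}\epsilon_{iab}(Bv^a)\varpi^b+\mathscr Q^i,\qquad \square_g\varrho=\mathscr Q,\qquad B\varpi^i=\varpi^a\partial_av^i,$$ $$\operatorname{div}\varpi=-\varpi^a\partial_a\varrho,\qquad B(\operatorname{curl}\varpi)^i=e^{\varrho}\varpi^a\partial_a\varpi^i-e^{\varrho}\varpi^i\operatorname{div}\varpi+\mathscr P^i_{(\varpi)},$$ where $B=\partial_t+v^a\partial_a$, $g$ is the acoustical metric, and $$\mathscr Q^i=-(1+c_s^{-1}c_s')(g^{-1})^{\alpha\beta}\partial_\alpha\varrho\,\partial_\beta v^i,$$ $$\mathscr Q=-3c_s^{-1}c_s'(g^{-1})^{\alpha\beta}\partial_\alpha\varrho\,\partial_\beta\varrho+2\sum_{1\le a<b\le3}\{\partial_av^a\partial_bv^b-\partial_av^b\partial_bv^a\},$$ $$\mathscr P^i_{(\varpi)}=\epsilon_{iab}\{(\partial_a\varpi^c)\partial_cv^b-(\partial_av^c)\partial_c\varpi^b\}.$$ Then, for solutions of this system, the inhomogeneous terms on the right-hand sides of the equations consist of two types: (i) terms that are linear in the first derivatives of the components of $\vec V$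 (with coefficients that are smooth functions of $\vec V$); and (ii) terms that are quadratic in the first derivatives of the components of $\vec V$ (with coefficients that are smooth functions of $\vec V$), namely $\mathscr Q^i$, $\mathscr Q$ and $\mathscr P^i_{(\varpi)}$, and each of these verifies the strong null condition relative to $g$ (as defined in the context, where the required identities are to hold for solutions of the system).
   Context: Notation. $x^0=t$; lowercase Greek indices $\alpha,\beta$ range over $0,1,2,3$, lowercase Latin over $1,2,3$, uppercase Latin $A,B$ (null frame indices) over $1,2,3,4$, uppercase Greek $\Theta,\Gamma$ over $0,\dots,6$; repeated indices are summed. $Xf=X^\alpha\partial_\alpha f$ for a vectorfield $X$. $\epsilon_{ijk}$ is fully antisymmetric with $\epsilon_{123}=1$. $\operatorname{div}V=\partial_aV^a$, $(\operatorname{curl}V)^i=\epsilon_{iab}\partial_aV^b$. Acoustical metric: $g=-dt\otimes dt+c_s^{-2}\sum_{a=1}^3(dx^a-v^adt)\otimes(dx^a-v^adt)$, with inverse $g^{-1}=-B\otimes B+c_s^2\sum_{a=1}^3\partial_a\otimes\partial_a$, where $B=\partial_t+v^a\partial_a$ is the material derivative vectorfield. At each point $g$ depends only on the value of $(\varrho,v)$ there. Covariant wave operator: $\square_g\phi=|\det g|^{-1/2}\partial_\alpha\{|\det g|^{1/2}(g^{-1})^{\alpha\beta}\partial_\beta\phi\}$, with $v^i$ treated as a scalar function. Null frame. A $g$-null frame at a point is a set of tangent vectors $\mathscr N=\{e_1,e_2,e_3:=\underline L,e_4:=L\}$ with $g(L,L)=g(\underline L,\underline L)=0$, $g(L,\underline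 L)=-2$, $g(L,e_A)=g(\underline L,e_A)=0$ for $A=1,2$, and $g(e_A,e_B)=\delta_{AB}$ for $A,B=1,2$. Given such a frame, scalars $M_\alpha^A$ are defined by $\partial_\alpha=\sum_{A=1}^4M_\alpha^Ae_A$. Labelling of unknowns: $V^0=\varrho$, $V^i=v^i$, $V^{i+3}=\varpi^i$ for $i=1,2,3$. Strong null condition. Let $\mathcal N(\vec V,\partial\vec V)=\mathrm f(\vec V)^{\alpha\beta}_{\Theta\Gamma}\,\partial_\alpha V^\Theta\,\partial_\beta V^\Gamma$, where the $\mathrm f(\vec V)^{\alpha\beta}_{\Theta\Gamma}$ are smooth functions of $\vec V$ (not necessarily vanishing at $0$) with $\mathrm f^{\alpha\beta}_{\Theta\Gamma}=\mathrm f^{\beta\alpha}_{\Gamma\Theta}$. $\mathcal N$ verifies the strong null condition relative to $g$ if for every $g$-null frame $\mathscr N$, when $\partial\vec V$ is expanded in the frame, $\mathcal N$ can be expressed in a form depending linearly (or not at all) on $L\vec V$ and on $\underline L\vec V$. Precisely: for every value $\vec V_0\in\mathbb R^7$ of the array of unknowns and every null frame $\mathscr N$ of the corresponding metric $g$, there exist scalars $\overline{\mathrm f}^{AB}_{\Theta\Gamma}$ and $\underline{\mathrm f}^{AB}_{\Theta\Gamma}$, depending only on $\vec V_0$ and $\mathscr N$ (not on the derivatives of $\vec V$), with $$\overline{\mathrm f}^{33}_{\Theta\Gamma}=\overline{\mathrm f}^{44}_{\Theta\Gamma}=0,\qquad\underline{\mathrm f}^{33}_{\Theta\Gamma}=\underline{\mathrm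 f}^{44}_{\Theta\Gamma}=0\qquad\text{for all }\Theta,\Gamma,$$ such that, for every solution $\vec V$ of the system and every point at which $\vec V=\vec V_0$, the following hold at that point: $$\mathrm f(\vec V)^{\alpha\beta}_{\Theta\Gamma}M_\alpha^3M_\beta^3(e_3V^\Theta)(e_3V^\Gamma)=\overline{\mathrm f}^{AB}_{\Theta\Gamma}(e_AV^\Theta)(e_BV^\Gamma),$$ $$\mathrm f(\vec V)^{\alpha\beta}_{\Theta\Gamma}M_\alpha^4M_\beta^4(e_4V^\Theta)(e_4V^\Gamma)=\underline{\mathrm f}^{AB}_{\Theta\Gamma}(e_AV^\Theta)(e_BV^\Gamma).$$ *)

theory Defs
  imports "HOL-Analysis.Analysis"
begin

section \<open>Smooth functions\<close>

text \<open>For open \<open>S\<close>: \<open>f\<close> is \<open>k\<close> times continuously differentiable on \<open>S\<close>.\<close>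

primrec Ck_on ::
  "nat \<Rightarrow> 'a::real_normed_vector set \<Rightarrow> ('a \<Rightarrow> 'b::real_normed_vector) \<Rightarrow> bool" where
  "Ck_on 0 S f \<longleftrightarrow> continuous_on S f"
| "Ck_on (Suc k) S f \<longleftrightarrow>
     (\<forall>x\<in>S. f differentiable (at x)) \<and>
     (\<forall>h. Ck_on k S (\<lambda>x. frechet_derivative f (at x) h))"

definition smooth_on ::
  "'a::real_normed_vector set \<Rightarrow> ('a \<Rightarrow> 'b::real_normed_vector) \<Rightarrow> bool" where
  "smooth_on S f \<longleftrightarrow> (\<forall>k. Ck_on k S f)"


section \<open>Indices\<close>

text \<open>
  Spacetime is \<open>real^4\<close> with the coordinates indexed by \<open>0, 1, 2, 3 :: 4\<close>, where the index
  \<open>0\<close> is time.  The array of unknowns is an element of \<open>real^7\<close>, indexed by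
  \<open>0, \<dots>, 6 :: 7\<close>: density, velocity, specific vorticity.  Latin indices have type \<open>3\<close>.
  Numerals of these types are taken modulo the size of the type, so \<open>(3::3) = 0\<close> and
  \<open>(4::4) = 0\<close>; the maps below therefore cannot be \<open>of_nat\<close>-like coercions, and the order
  on the type \<open>3\<close> is not the order of the indices \<open>1, 2, 3\<close>.
\<close>

definition sp :: "3 \<Rightarrow> 4" where
  "sp i = (if i = 1 then 1 else if i = 2 then 2 else 3)"

definition vel :: "3 \<Rightarrow> 7" where
  "vel i = (if i = 1 then 1 else if i = 2 then 2 else 3)"

definition vort :: "3 \<Rightarrow> 7" where
  "vort i = (if i = 1 then 4 else if i = 2 then 5 else 6)"

definition eps :: "3 \<Rightarrow> 3 \<Rightarrow> 3 \<Rightarrow> real" where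
  "eps i j k =
    (if (i, j, k) \<in> {(1, 2, 3), (2, 3, 1), (3, 1, 2)} then 1
     else if (i, j, k) \<in> {(1, 3, 2), (3, 2, 1), (2, 1, 3)} then -1
     else 0)"


section \<open>Acoustical geometry\<close>

text \<open>
  The functions of this section depend on the value \<open>V :: real^7\<close> of the unknowns at a point.
\<close>

text \<open>The material derivative vectorfield \<open>\<partial>\<^sub>t + v\<^sup>a \<partial>\<^sub>a\<close>.\<close>

definition matB :: "real^7 \<Rightarrow> real^4" where
  "matB V = axis 0 1 + (\<Sum>a\<in>UNIV. V $ vel a *\<^sub>R axis (sp a) 1)"

definition acou_metric :: "(real \<Rightarrow> real) \<Rightarrow> real^7 \<Rightarrow> real^4 \<Rightarrow> real^4 \<Rightarrow> real" where
  "acou_metric cs V X Y =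
     - (X $ 0 * Y $ 0)
     + (1 / (cs (V $ 0))\<^sup>2) *
       (\<Sum>a\<in>UNIV. (X $ sp a - V $ vel a * X $ 0) * (Y $ sp a - V $ vel a * Y $ 0))"

definition acou_mat :: "(real \<Rightarrow> real) \<Rightarrow> real^7 \<Rightarrow> real^4^4" where
  "acou_mat cs V = (\<chi> \<alpha> \<beta>. acou_metric cs V (axis \<alpha> 1) (axis \<beta> 1))"

definition acou_inv :: "(real \<Rightarrow> real) \<Rightarrow> real^7 \<Rightarrow> real^4^4" where
  "acou_inv cs V = (\<chi> \<alpha> \<beta>.
     - (matB V $ \<alpha> * matB V $ \<beta>)
     + (cs (V $ 0))\<^sup>2 * (\<Sum>a\<in>UNIV. axis (sp a) 1 $ \<alpha> * axis (sp a) 1 $ \<beta>))"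

text \<open>The frame vectors are \<open>e 1\<close>, \<open>e 2\<close>, \<open>e 3\<close> (ingoing) and \<open>e 4\<close> (outgoing).\<close>

definition null_frame :: "(real \<Rightarrow> real) \<Rightarrow> real^7 \<Rightarrow> (4 \<Rightarrow> real^4) \<Rightarrow> bool" where
  "null_frame cs V e \<longleftrightarrow>
     acou_metric cs V (e 4) (e 4) = 0 \<and> acou_metric cs V (e 3) (e 3) = 0 \<and>
     acou_metric cs V (e 4) (e 3) = -2 \<and>
     (\<forall>A\<in>{1, 2}. acou_metric cs V (e 4) (e A) = 0 \<and> acou_metric cs V (e 3) (e A) = 0) \<and>
     (\<forall>A\<in>{1, 2}. \<forall>B\<in>{1, 2}. acou_metric cs V (e A) (e B) = (if A = B then 1 else 0))"

text \<open>\<open>frame_coeff e \<alpha> A\<close> is the scalar \<open>M\<^sub>\<alpha>\<^sup>A\<close>; see lemma \<open>frame_coeff_ex1\<close> below.\<close>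

definition frame_coeff :: "(4 \<Rightarrow> real^4) \<Rightarrow> 4 \<Rightarrow> 4 \<Rightarrow> real" where
  "frame_coeff e = (THE M. \<forall>\<alpha>. axis \<alpha> 1 = (\<Sum>A\<in>UNIV. M \<alpha> A *\<^sub>R e A))"


section \<open>First derivatives and the wave operator\<close>

text \<open>
  A vectorfield \<open>X\<close> acts on \<open>f\<close> at \<open>x\<close> by \<open>X \<bullet> grad f x\<close>: here the inner product of
  \<open>real^4\<close> is just the contraction \<open>X\<^sup>\<alpha> \<partial>\<^sub>\<alpha> f\<close>.
\<close>

definition grad :: "(real^4 \<Rightarrow> real) \<Rightarrow> real^4 \<Rightarrow> real^4" where
  "grad f x = (\<chi> \<alpha>. frechet_derivative f (at x) (axis \<alpha> 1))"

text \<open>\<open>derivs V x $ \<Theta> $ \<alpha>\<close> is \<open>\<partial>\<^sub>\<alpha> V\<^sup>\<Theta>\<close> at \<open>x\<close>.\<close>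

definition derivs :: "(real^4 \<Rightarrow> real^7) \<Rightarrow> real^4 \<Rightarrow> real^4^7" where
  "derivs V x = (\<chi> \<Theta>. grad (\<lambda>y. V y $ \<Theta>) x)"

definition box_g ::
  "(real \<Rightarrow> real) \<Rightarrow> (real^4 \<Rightarrow> real^7) \<Rightarrow> (real^4 \<Rightarrow> real) \<Rightarrow> real^4 \<Rightarrow> real" where
  "box_g cs V \<phi> x =
     \<bar>det (acou_mat cs (V x))\<bar> powr (-1/2) *
     (\<Sum>\<alpha>\<in>UNIV. grad (\<lambda>y. \<Sum>\<beta>\<in>UNIV.
        \<bar>det (acou_mat cs (V y))\<bar> powr (1/2) * acou_inv cs (V y) $ \<alpha> $ \<beta> * grad \<phi> y $ \<beta>)
        x $ \<alpha>)"


section \<open>The inhomogeneous terms\<close>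

text \<open>
  Nonlinearities are functions of independent variables \<open>V :: real^7\<close> (the value of the
  unknowns) and \<open>D :: real^4^7\<close> (standing for their first derivatives, with
  \<open>D $ \<Theta> $ \<alpha> = \<partial>\<^sub>\<alpha> V\<^sup>\<Theta>\<close>).
\<close>

type_synonym nonlinearity = "real^7 \<Rightarrow> real^4^7 \<Rightarrow> real"

definition curl_vort :: "real^4^7 \<Rightarrow> 3 \<Rightarrow> real" where
  "curl_vort D i = (\<Sum>a\<in>UNIV. \<Sum>b\<in>UNIV. eps i a b * D $ vort b $ sp a)"

definition div_vort :: "real^4^7 \<Rightarrow> real" where
  "div_vort D = (\<Sum>a\<in>UNIV. D $ vort a $ sp a)"

definition Q_vel :: "(real \<Rightarrow> real) \<Rightarrow> 3 \<Rightarrow> nonlinearity" where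
  "Q_vel cs i V D =
     - (1 + deriv cs (V $ 0) / cs (V $ 0)) *
       (\<Sum>\<alpha>\<in>UNIV. \<Sum>\<beta>\<in>UNIV. acou_inv cs V $ \<alpha> $ \<beta> * D $ 0 $ \<alpha> * D $ vel i $ \<beta>)"

definition Q_dens :: "(real \<Rightarrow> real) \<Rightarrow> nonlinearity" where
  "Q_dens cs V D =
     - 3 * (deriv cs (V $ 0) / cs (V $ 0)) *
       (\<Sum>\<alpha>\<in>UNIV. \<Sum>\<beta>\<in>UNIV. acou_inv cs V $ \<alpha> $ \<beta> * D $ 0 $ \<alpha> * D $ 0 $ \<beta>)
     + 2 * (\<Sum>(a, b)\<in>{(1, 2), (1, 3), (2, 3)}.
         D $ vel a $ sp a * D $ vel b $ sp b - D $ vel b $ sp a * D $ vel a $ sp b)"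

definition P_vort :: "3 \<Rightarrow> nonlinearity" where
  "P_vort i V D =
     (\<Sum>a\<in>UNIV. \<Sum>b\<in>UNIV. eps i a b *
       ((\<Sum>c\<in>UNIV. D $ vort c $ sp a * D $ vel b $ sp c)
        - (\<Sum>c\<in>UNIV. D $ vel c $ sp a * D $ vort b $ sp c)))"

definition rhs_vel :: "(real \<Rightarrow> real) \<Rightarrow> 3 \<Rightarrow> nonlinearity" where
  "rhs_vel cs i V D =
     - (cs (V $ 0))\<^sup>2 * exp (V $ 0) * curl_vort D i
     + 2 * exp (V $ 0) *
       (\<Sum>a\<in>UNIV. \<Sum>b\<in>UNIV. eps i a b * (matB V \<bullet> D $ vel a) * V $ vort b)
     + Q_vel cs i V D"

definition rhs_dens :: "(real \<Rightarrow> real) \<Rightarrow> nonlinearity" where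
  "rhs_dens cs V D = Q_dens cs V D"

definition rhs_vort :: "3 \<Rightarrow> nonlinearity" where
  "rhs_vort i V D = (\<Sum>a\<in>UNIV. V $ vort a * D $ vel i $ sp a)"

definition rhs_div :: nonlinearity where
  "rhs_div V D = - (\<Sum>a\<in>UNIV. V $ vort a * D $ 0 $ sp a)"

definition rhs_curl :: "3 \<Rightarrow> nonlinearity" where
  "rhs_curl i V D =
     exp (V $ 0) * (\<Sum>a\<in>UNIV. V $ vort a * D $ vort i $ sp a)
     - exp (V $ 0) * V $ vort i * div_vort D
     + P_vort i V D"

definition euler_solution ::
  "(real \<Rightarrow> real) \<Rightarrow> (real^4) set \<Rightarrow> (real^4 \<Rightarrow> real^7) \<Rightarrow> bool" where
  "euler_solution cs U V \<longleftrightarrow>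
     open U \<and> smooth_on U V \<and>
     (\<forall>x\<in>U.
       (\<forall>i. box_g cs V (\<lambda>y. V y $ vel i) x = rhs_vel cs i (V x) (derivs V x)) \<and>
       box_g cs V (\<lambda>y. V y $ 0) x = rhs_dens cs (V x) (derivs V x) \<and>
       (\<forall>i. matB (V x) \<bullet> grad (\<lambda>y. V y $ vort i) x = rhs_vort i (V x) (derivs V x)) \<and>
       div_vort (derivs V x) = rhs_div (V x) (derivs V x) \<and>
       (\<forall>i. matB (V x) \<bullet> grad (\<lambda>y. curl_vort (derivs V y) i) x
              = rhs_curl i (V x) (derivs V x)))"


section \<open>Linear terms, quadratic terms and the strong null condition\<close>

definition linear_in_derivs :: "nonlinearity \<Rightarrow> bool" where
  "linear_in_derivs N \<longleftrightarrow>
     (\<exists>h :: real^7 \<Rightarrow> 4 \<Rightarrow> 7 \<Rightarrow> real.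
        (\<forall>\<alpha> \<Theta>. smooth_on UNIV (\<lambda>V. h V \<alpha> \<Theta>)) \<and>
        (\<forall>V D. N V D = (\<Sum>\<alpha>\<in>UNIV. \<Sum>\<Theta>\<in>UNIV. h V \<alpha> \<Theta> * D $ \<Theta> $ \<alpha>)))"

text \<open>
  \<open>f V \<alpha> \<beta> \<Theta> \<Gamma>\<close> is the coefficient of \<open>\<partial>\<^sub>\<alpha> V\<^sup>\<Theta> \<partial>\<^sub>\<beta> V\<^sup>\<Gamma>\<close>.  The symmetry requirement makes \<open>f\<close>
  uniquely determined by \<open>N\<close>.
\<close>

type_synonym coefficients = "real^7 \<Rightarrow> 4 \<Rightarrow> 4 \<Rightarrow> 7 \<Rightarrow> 7 \<Rightarrow> real"

definition quadratic_in_derivs :: "nonlinearity \<Rightarrow> coefficients \<Rightarrow> bool" where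
  "quadratic_in_derivs N f \<longleftrightarrow>
     (\<forall>\<alpha> \<beta> \<Theta> \<Gamma>. smooth_on UNIV (\<lambda>V. f V \<alpha> \<beta> \<Theta> \<Gamma>)) \<and>
     (\<forall>V \<alpha> \<beta> \<Theta> \<Gamma>. f V \<alpha> \<beta> \<Theta> \<Gamma> = f V \<beta> \<alpha> \<Gamma> \<Theta>) \<and>
     (\<forall>V D. N V D =
        (\<Sum>\<alpha>\<in>UNIV. \<Sum>\<beta>\<in>UNIV. \<Sum>\<Theta>\<in>UNIV. \<Sum>\<Gamma>\<in>UNIV. f V \<alpha> \<beta> \<Theta> \<Gamma> * D $ \<Theta> $ \<alpha> * D $ \<Gamma> $ \<beta>))"

text \<open>
  \<open>diag_part f V e A D\<close> is
  \<open>f(V)\<^sup>\<alpha>\<^sup>\<beta>\<^sub>\<Theta>\<^sub>\<Gamma> M\<^sub>\<alpha>\<^sup>A M\<^sub>\<beta>\<^sup>A (e\<^sub>A V\<^sup>\<Theta>) (e\<^sub>A V\<^sup>\<Gamma>)\<close>, without summation over \<open>A\<close>.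
\<close>

definition diag_part ::
  "coefficients \<Rightarrow> real^7 \<Rightarrow> (4 \<Rightarrow> real^4) \<Rightarrow> 4 \<Rightarrow> real^4^7 \<Rightarrow> real" where
  "diag_part f V e A D =
     (\<Sum>\<alpha>\<in>UNIV. \<Sum>\<beta>\<in>UNIV. \<Sum>\<Theta>\<in>UNIV. \<Sum>\<Gamma>\<in>UNIV.
        f V \<alpha> \<beta> \<Theta> \<Gamma> * frame_coeff e \<alpha> A * frame_coeff e \<beta> A * (e A \<bullet> D $ \<Theta>) * (e A \<bullet> D $ \<Gamma>))"

definition frame_form ::
  "(4 \<Rightarrow> 4 \<Rightarrow> 7 \<Rightarrow> 7 \<Rightarrow> real) \<Rightarrow> (4 \<Rightarrow> real^4) \<Rightarrow> real^4^7 \<Rightarrow> real" where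
  "frame_form k e D =
     (\<Sum>A\<in>UNIV. \<Sum>B\<in>UNIV. \<Sum>\<Theta>\<in>UNIV. \<Sum>\<Gamma>\<in>UNIV. k A B \<Theta> \<Gamma> * (e A \<bullet> D $ \<Theta>) * (e B \<bullet> D $ \<Gamma>))"

definition strong_null_condition :: "(real \<Rightarrow> real) \<Rightarrow> nonlinearity \<Rightarrow> bool" where
  "strong_null_condition cs N \<longleftrightarrow>
     (\<exists>f. quadratic_in_derivs N f \<and>
       (\<forall>V0 e. null_frame cs V0 e \<longrightarrow>
         (\<exists>fover funder :: 4 \<Rightarrow> 4 \<Rightarrow> 7 \<Rightarrow> 7 \<Rightarrow> real.
           (\<forall>\<Theta> \<Gamma>. fover 3 3 \<Theta> \<Gamma> = 0 \<and> fover 4 4 \<Theta> \<Gamma> = 0 \<and>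
                  funder 3 3 \<Theta> \<Gamma> = 0 \<and> funder 4 4 \<Theta> \<Gamma> = 0) \<and>
           (\<forall>U V x. euler_solution cs U V \<and> x \<in> U \<and> V x = V0 \<longrightarrow>
              diag_part f (V x) e 3 (derivs V x) = frame_form fover e (derivs V x) \<and>
              diag_part f (V x) e 4 (derivs V x) = frame_form funder e (derivs V x)))))"


section \<open>Consistency of the definitions\<close>

lemma UNIV_4_from_0: "(UNIV :: 4 set) = {0, 1, 2, 3}"
proof -
  have four: "(4::4) = 0" by simp
  show ?thesis unfolding UNIV_4 four by blast
qed

lemma sum_4_from_0: "(\<Sum>\<alpha>\<in>UNIV. f (\<alpha>::4)) = f 0 + f 1 + f 2 + (f 3 :: 'a::comm_monoid_add)"
  unfolding UNIV_4_from_0 by (simp add: add.assoc)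

lemma all_4_from_0: "(\<forall>\<alpha>::4. P \<alpha>) \<longleftrightarrow> P 0 \<and> P 1 \<and> P 2 \<and> P 3"
proof -
  have "(\<forall>\<alpha>::4. P \<alpha>) \<longleftrightarrow> (\<forall>\<alpha>\<in>{0, 1, 2, 3}. P \<alpha>)"
    unfolding UNIV_4_from_0[symmetric] by simp
  then show ?thesis by simp
qed

lemma index_maps:
  "sp 1 = 1" "sp 2 = 2" "sp 3 = 3" "vel 1 = 1" "vel 2 = 2" "vel 3 = 3"
  by (simp_all add: sp_def vel_def)

lemma acou_metric_explicit:
  "acou_metric cs V X Y = - (X $ 0 * Y $ 0) + (1 / (cs (V $ 0))\<^sup>2) *
     ((X $ 1 - V $ 1 * X $ 0) * (Y $ 1 - V $ 1 * Y $ 0)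
      + (X $ 2 - V $ 2 * X $ 0) * (Y $ 2 - V $ 2 * Y $ 0)
      + (X $ 3 - V $ 3 * X $ 0) * (Y $ 3 - V $ 3 * Y $ 0))"
  by (simp only: acou_metric_def sum_3 index_maps)

lemma axis_4: "axis 0 (1::real) $ (0::4) = 1" "axis 0 (1::real) $ (1::4) = 0" "axis 0 (1::real) $ (2::4) = 0" "axis 0 (1::real) $ (3::4) = 0"
  "axis 1 (1::real) $ (0::4) = 0" "axis 1 (1::real) $ (1::4) = 1" "axis 1 (1::real) $ (2::4) = 0" "axis 1 (1::real) $ (3::4) = 0"
  "axis 2 (1::real) $ (0::4) = 0" "axis 2 (1::real) $ (1::4) = 0" "axis 2 (1::real) $ (2::4) = 1" "axis 2 (1::real) $ (3::4) = 0"
  "axis 3 (1::real) $ (0::4) = 0" "axis 3 (1::real) $ (1::4) = 0" "axis 3 (1::real) $ (2::4) = 0" "axis 3 (1::real) $ (3::4) = 1"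
  by (simp_all add: axis_def)

lemma acou_metric_expand:
  "acou_metric cs V X Y = (\<Sum>\<alpha>\<in>UNIV. \<Sum>\<beta>\<in>UNIV. X $ \<alpha> * acou_mat cs V $ \<alpha> $ \<beta> * Y $ \<beta>)"
proof -
  define w where "w = 1 / (cs (V $ 0))\<^sup>2"
  show ?thesis
    unfolding acou_mat_def acou_metric_explicit w_def[symmetric] sum_4_from_0 vec_lambda_beta axis_4
    by (simp add: algebra_simps)
qed

lemma acou_inv_correct:
  assumes "cs (V $ 0) \<noteq> 0"
  shows "acou_mat cs V ** acou_inv cs V = mat 1"
proof -
  define c where "c = (cs (V $ 0))\<^sup>2"
  have c: "c \<noteq> 0" using assms by (simp add: c_def)
  have B: "matB V $ 0 = 1" "matB V $ 1 = V $ 1" "matB V $ 2 = V $ 2" "matB V $ 3 = V $ 3"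
    by (simp_all add: matB_def sum_3 index_maps axis_4)
  have m: "mat 1 $ i $ j = (axis i 1 :: real^4) $ j" for i j
    by (simp add: mat_def axis_def)
  show ?thesis
    unfolding vec_eq_iff all_4_from_0 matrix_matrix_mult_def acou_mat_def acou_inv_def
      acou_metric_explicit vec_lambda_beta sum_4_from_0 sum_3 index_maps axis_4 B m
      c_def[symmetric]
    using c by simp (simp add: field_simps)
qed

lemma frame_coeff_ex1:
  assumes "null_frame cs V e"
  shows "\<exists>!M. \<forall>\<alpha>. axis \<alpha> 1 = (\<Sum>A\<in>UNIV. M \<alpha> A *\<^sub>R e A)"
proof -
  define E :: "real^4^4" where "E = (\<chi> A \<alpha>. e A $ \<alpha>)"
  define H :: "real^4^4" where "H = (\<chi> A B. if A = 1 \<and> B = 1 \<or> A = 2 \<and> B = 2 then 1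
      else if A = 3 \<and> B = 4 \<or> A = 4 \<and> B = 3 then -1/2 else 0)"
  define Gr :: "real^4^4" where "Gr = (\<chi> A B. acou_metric cs V (e A) (e B))"
  have comm: "acou_metric cs V X Y = acou_metric cs V Y X" for X Y
    by (simp add: acou_metric_def mult.commute)
  have gr: "Gr = E ** (acou_mat cs V ** transpose E)"
    by (simp add: vec_eq_iff Gr_def E_def acou_metric_expand matrix_matrix_mult_def transpose_def
        sum_distrib_left mult.assoc)
  have d: "(1::4) \<noteq> 2" "(1::4) \<noteq> 3" "(1::4) \<noteq> 4" "(2::4) \<noteq> 3" "(2::4) \<noteq> 4" "(3::4) \<noteq> 4"
    by simp_all
  have u: "acou_metric cs V (e 4) (e 4) = 0" "acou_metric cs V (e 3) (e 3) = 0" "acou_metric cs V (e 4) (e 3) = -2"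
    "acou_metric cs V (e 4) (e 1) = 0" "acou_metric cs V (e 4) (e 2) = 0"
    "acou_metric cs V (e 3) (e 1) = 0" "acou_metric cs V (e 3) (e 2) = 0"
    "acou_metric cs V (e 1) (e 1) = 1" "acou_metric cs V (e 2) (e 2) = 1"
    "acou_metric cs V (e 1) (e 2) = 0" "acou_metric cs V (e 2) (e 1) = 0"
    using assms unfolding null_frame_def by auto
  have u': "acou_metric cs V (e 3) (e 4) = -2" "acou_metric cs V (e 1) (e 4) = 0" "acou_metric cs V (e 2) (e 4) = 0"
    "acou_metric cs V (e 1) (e 3) = 0" "acou_metric cs V (e 2) (e 3) = 0"
    by (simp_all only: comm[of "e 3" "e 4"] comm[of "e 1" "e 4"] comm[of "e 2" "e 4"]
        comm[of "e 1" "e 3"] comm[of "e 2" "e 3"] u)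
  have "Gr ** H = mat 1"
    unfolding vec_eq_iff forall_4 Gr_def H_def matrix_matrix_mult_def mat_def sum_4 vec_lambda_beta u u'
    by (simp only: d d[symmetric] simp_thms if_True if_False) simp
  then have "E ** (acou_mat cs V ** transpose E ** H) = mat 1"
    by (simp add: gr matrix_mul_assoc)
  then obtain F where EF: "E ** F = mat 1" by blast
  then have FE: "F ** E = mat 1" by (simp add: matrix_left_right_inverse)
  have iff: "(\<forall>\<alpha>. axis \<alpha> 1 = (\<Sum>A\<in>UNIV. M \<alpha> A *\<^sub>R e A)) \<longleftrightarrow> (\<chi> \<alpha> A. M \<alpha> A) ** E = mat 1" for M
    by (auto simp: vec_eq_iff matrix_matrix_mult_def mat_def E_def axis_def)
  show ?thesis
  proof (rule ex1I[of _ "\<lambda>\<alpha> A. F $ \<alpha> $ A"])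
    show "\<forall>\<alpha>. axis \<alpha> 1 = (\<Sum>A\<in>UNIV. F $ \<alpha> $ A *\<^sub>R e A)"
      using iff[of "\<lambda>\<alpha> A. F $ \<alpha> $ A"] FE by simp
  next
    fix M assume "\<forall>\<alpha>. axis \<alpha> 1 = (\<Sum>A\<in>UNIV. M \<alpha> A *\<^sub>R e A)"
    then have "(\<chi> \<alpha> A. M \<alpha> A) ** E = mat 1" by (simp only: iff)
    then have "(\<chi> \<alpha> A. M \<alpha> A) = F"
      using EF matrix_mul_assoc[of "\<chi> \<alpha> A. M \<alpha> A" E F] by simp
    then have "(\<chi> \<alpha> A. M \<alpha> A) $ \<alpha> $ A = F $ \<alpha> $ A" for \<alpha> A by (rule arg_cong)
    then show "M = (\<lambda>\<alpha> A. F $ \<alpha> $ A)" by (simp add: fun_eq_iff)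
  qed
qed

end

theory Submission
  imports Defs
begin

text \<open>
  The linear terms are read off from the definitions, so the substance is the strong null
  condition.  Let \<open>A\<close> be one of the null indices \<open>3, 4\<close> and let \<open>m\<close> be the covector
  \<open>m\<^sub>\<alpha> = M\<^sub>\<alpha>\<^sup>A\<close>.  The \<open>A\<close>-\<open>A\<close> part of a quadratic term \<open>N\<close> is the value of \<open>N\<close> after each
  \<open>\<partial>\<^sub>\<alpha> V\<^sup>\<Theta>\<close> has been replaced by \<open>m\<^sub>\<alpha> (e\<^sub>A V\<^sup>\<Theta>)\<close> (lemma \<open>diag_part_eq_restrict\<close>).  Hence the
  coefficients of \<open>N\<close> never have to be computed: it suffices that smooth coefficients exist,
  which follows from closure properties of quadratic expressions, and the rest is the
  evaluation of \<open>N\<close> on such arrays of rank one.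

  Up to the factor \<open>-1/2\<close>, the covector \<open>m\<close> is metrically dual to the other null vector of the
  frame.  It is therefore null for the inverse metric (\<open>covec_null\<close>), so the terms
  \<open>(g\<^sup>-\<^sup>1)\<^sup>\<alpha>\<^sup>\<beta> \<partial>\<^sub>\<alpha>\<phi> \<partial>\<^sub>\<beta>\<psi>\<close> contribute nothing; the remaining terms of \<open>Q_dens\<close> cancel on arrays of
  rank one by antisymmetry.

  For \<open>P_vort\<close> the rank-one value is
  \<open>\<epsilon>\<^sub>i\<^sub>a\<^sub>b m\<^sub>a m\<^sub>c {(e\<^sub>A \<omega>\<^sup>c)(e\<^sub>A v\<^sup>b) - (e\<^sub>A v\<^sup>c)(e\<^sub>A \<omega>\<^sup>b)}\<close>, where \<open>\<omega>\<close> is the specific vorticity, and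
  this need not vanish for arbitrary functions.  Here the transport equation
  \<open>B \<omega>\<^sup>i = \<omega>\<^sup>a \<partial>\<^sub>a v\<^sup>i\<close> enters.  The vectorfield \<open>B\<close> is timelike, so it is transversal to the null
  hyperplane that is annihilated by \<open>m\<close>, and its component \<open>B\<^sup>A\<close> is nonzero
  (\<open>matB_covec_nonzero\<close>).  The equation can thus be solved for \<open>e\<^sub>A \<omega>\<^sup>i\<close>:
  it equals \<open>\<lambda> (e\<^sub>A v\<^sup>i)\<close>, with \<open>\<lambda>\<close> the same for all three \<open>i\<close>, plus derivatives along the other
  frame vectors.  The contributions of \<open>\<lambda> (e\<^sub>A v)\<close> cancel inside the braces, and every product
  that is left has exactly one factor \<open>e\<^sub>A v\<close> (\<open>P_vort_restrict\<close>).
\<close>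


section \<open>Smooth real-valued functions\<close>

lemma Ck_on_SucI:
  fixes f :: "'a::real_normed_vector \<Rightarrow> 'b::real_normed_vector"
  assumes "\<And>x. (f has_derivative f' x) (at x)" and "\<And>h. Ck_on k UNIV (\<lambda>x. f' x h)"
  shows "Ck_on (Suc k) UNIV f"
proof -
  have "frechet_derivative f (at x) = f' x" for x
    using frechet_derivative_at[OF assms(1)] by simp
  then show ?thesis using assms by (auto simp: differentiable_def)
qed

lemma Ck_on_SucD:
  assumes "Ck_on (Suc k) UNIV f"
  shows "(f has_derivative frechet_derivative f (at x)) (at x)"
    and "Ck_on k UNIV (\<lambda>x. frechet_derivative f (at x) h)"
  using assms by (auto simp: frechet_derivative_works)

lemma Ck_on_lower: "Ck_on (Suc k) UNIV f \<Longrightarrow> Ck_on k UNIV f"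
proof (induction k arbitrary: f)
  case 0
  then show ?case
    by (auto intro!: continuous_at_imp_continuous_on differentiable_imp_continuous_within)
next
  case (Suc k)
  then show ?case by (metis Ck_on.simps(2))
qed

lemma Ck_on_const: "Ck_on k UNIV (\<lambda>x. c)"
proof (induction k arbitrary: c)
  case (Suc k)
  show ?case by (rule Ck_on_SucI[where f' = "\<lambda>x h. 0"]) (auto intro: Suc)
qed simp

lemma Ck_on_add: "Ck_on k UNIV f \<Longrightarrow> Ck_on k UNIV g \<Longrightarrow> Ck_on k UNIV (\<lambda>x. f x + g x)"
proof (induction k arbitrary: f g)
  case 0
  then show ?case by (auto intro: continuous_on_add)
next
  case (Suc k)
  show ?case
    by (rule Ck_on_SucI, rule has_derivative_add)
      (use Suc.prems in \<open>auto intro: Ck_on_SucD Suc.IH simp del: Ck_on.simps\<close>)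
qed

lemma Ck_on_mult:
  fixes f g :: "'a::real_normed_vector \<Rightarrow> real"
  shows "Ck_on k UNIV f \<Longrightarrow> Ck_on k UNIV g \<Longrightarrow> Ck_on k UNIV (\<lambda>x. f x * g x)"
proof (induction k arbitrary: f g)
  case 0
  then show ?case by (auto intro: continuous_on_mult)
next
  case (Suc k)
  show ?case
  proof (rule Ck_on_SucI)
    show "((\<lambda>x. f x * g x) has_derivative (\<lambda>h. f x * frechet_derivative g (at x) h
        + frechet_derivative f (at x) h * g x)) (at x)" for x
      by (intro has_derivative_mult Ck_on_SucD(1)[OF Suc.prems(1)] Ck_on_SucD(1)[OF Suc.prems(2)])
  qed (intro Ck_on_add Suc.IH Ck_on_lower[OF Suc.prems(1)] Ck_on_lower[OF Suc.prems(2)]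
      Ck_on_SucD(2)[OF Suc.prems(1)] Ck_on_SucD(2)[OF Suc.prems(2)])
qed

text \<open>
  The derivative of \<open>1/f\<close> is a product of \<open>f'\<close> with two copies of \<open>1/f\<close> itself, so the
  induction on the order of differentiability closes with \<open>Ck_on_mult\<close>.
\<close>

lemma Ck_on_inverse:
  fixes f :: "'a::real_normed_vector \<Rightarrow> real"
  assumes nz: "\<And>x. f x \<noteq> 0"
  shows "Ck_on k UNIV f \<Longrightarrow> Ck_on k UNIV (\<lambda>x. inverse (f x))"
proof (induction k)
  case 0
  then show ?case using nz by (auto intro: continuous_on_inverse)
next
  case (Suc k)
  have inv: "Ck_on k UNIV (\<lambda>x. inverse (f x))"
    using Suc Ck_on_lower by blast
  show ?case
  proof (rule Ck_on_SucI)
    show "((\<lambda>x. inverse (f x)) has_derivative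
        (\<lambda>h. (-1) * (inverse (f x) * frechet_derivative f (at x) h * inverse (f x)))) (at x)" for x
      using Deriv.has_derivative_inverse[OF nz Ck_on_SucD(1)[OF Suc.prems], of x] by simp
  qed (intro Ck_on_mult Ck_on_const inv Ck_on_SucD(2)[OF Suc.prems])
qed

lemma Ck_on_deriv:
  fixes f :: "real \<Rightarrow> real"
  assumes "Ck_on (Suc k) UNIV f"
  shows "(f has_real_derivative deriv f x) (at x)" and "Ck_on k UNIV (deriv f)"
proof -
  have D: "(f has_real_derivative deriv f x) (at x)" for x
    using assms by (simp add: DERIV_deriv_iff_real_differentiable)
  then show "(f has_real_derivative deriv f x) (at x)" .
  have "frechet_derivative f (at x) = (\<lambda>h. deriv f x * h)" for x
    using frechet_derivative_at[OF D[of x, unfolded has_field_derivative_def]] by simp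
  then have "(\<lambda>x. frechet_derivative f (at x) 1) = deriv f" by simp
  then show "Ck_on k UNIV (deriv f)"
    using Ck_on_SucD(2)[OF assms, of 1] by simp
qed

text \<open>
  Functions of one component of the unknowns, such as \<open>cs (V $ 0)\<close>, are the only
  compositions that occur.  For a linear inner function the chain rule gives a constant multiple
  of \<open>g' \<circ> l\<close>, so the induction needs no composition other than with \<open>l\<close>.
\<close>

lemma Ck_on_compose_bounded_linear:
  fixes g :: "real \<Rightarrow> real" and l :: "'a::real_normed_vector \<Rightarrow> real"
  assumes l: "bounded_linear l"
  shows "Ck_on k UNIV g \<Longrightarrow> Ck_on k UNIV (\<lambda>x. g (l x))"
proof (induction k arbitrary: g)
  case 0
  then show ?case
    using continuous_on_compose2[of UNIV g UNIV l] linear_continuous_on[OF l] by simp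
next
  case (Suc k)
  show ?case
  proof (rule Ck_on_SucI)
    show "((\<lambda>x. g (l x)) has_derivative (\<lambda>h. deriv g (l x) * l h)) (at x)" for x
      using has_derivative_compose[OF bounded_linear_imp_has_derivative[OF l]
          Ck_on_deriv(1)[OF Suc.prems, unfolded has_field_derivative_def]] .
  qed (intro Ck_on_mult Ck_on_const Suc.IH Ck_on_deriv(2)[OF Suc.prems])
qed

lemma smooth_on_const: "smooth_on UNIV (\<lambda>x. c)"
  by (simp add: smooth_on_def Ck_on_const)

lemma smooth_on_add:
  "smooth_on UNIV f \<Longrightarrow> smooth_on UNIV g \<Longrightarrow> smooth_on UNIV (\<lambda>x. f x + g x)"
  by (simp add: smooth_on_def Ck_on_add)

lemma smooth_on_mult:
  fixes f g :: "'a::real_normed_vector \<Rightarrow> real"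
  shows "smooth_on UNIV f \<Longrightarrow> smooth_on UNIV g \<Longrightarrow> smooth_on UNIV (\<lambda>x. f x * g x)"
  by (simp add: smooth_on_def Ck_on_mult)

lemma smooth_on_minus:
  fixes f :: "'a::real_normed_vector \<Rightarrow> real"
  shows "smooth_on UNIV f \<Longrightarrow> smooth_on UNIV (\<lambda>x. - f x)"
  using smooth_on_mult[OF smooth_on_const[of "-1"], of f] by simp

lemma smooth_on_power:
  fixes f :: "'a::real_normed_vector \<Rightarrow> real"
  shows "smooth_on UNIV f \<Longrightarrow> smooth_on UNIV (\<lambda>x. f x ^ n)"
  by (induction n) (auto intro: smooth_on_const smooth_on_mult)

lemma smooth_on_divide:
  fixes f g :: "'a::real_normed_vector \<Rightarrow> real"
  assumes "smooth_on UNIV f" "smooth_on UNIV g" "\<And>x. g x \<noteq> 0"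
  shows "smooth_on UNIV (\<lambda>x. f x / g x)"
  using assms by (simp add: smooth_on_def divide_inverse Ck_on_mult Ck_on_inverse)

lemma smooth_on_sum:
  "finite I \<Longrightarrow> (\<And>i. i \<in> I \<Longrightarrow> smooth_on UNIV (f i)) \<Longrightarrow> smooth_on UNIV (\<lambda>x. \<Sum>i\<in>I. f i x)"
  by (induction I rule: finite_induct) (auto intro: smooth_on_const smooth_on_add)

lemma smooth_on_deriv:
  fixes f :: "real \<Rightarrow> real"
  shows "smooth_on UNIV f \<Longrightarrow> smooth_on UNIV (deriv f)"
  unfolding smooth_on_def using Ck_on_deriv(2) by blast

lemma smooth_on_component_compose:
  fixes g :: "real \<Rightarrow> real"
  assumes "smooth_on UNIV g"
  shows "smooth_on UNIV (\<lambda>V::real^'n. g (V $ j))"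
  using assms Ck_on_compose_bounded_linear[OF bounded_linear_vec_nth]
  by (auto simp: smooth_on_def)

lemma smooth_on_ident: "smooth_on UNIV (\<lambda>x::real. x)"
proof -
  have "Ck_on k UNIV (\<lambda>x::real. x)" for k
  proof (cases k)
    case (Suc n)
    show ?thesis unfolding Suc
      by (rule Ck_on_SucI[where f' = "\<lambda>x h. h"]) (auto intro: Ck_on_const)
  qed simp
  then show ?thesis by (simp add: smooth_on_def)
qed

lemma smooth_on_exp: "smooth_on UNIV (exp :: real \<Rightarrow> real)"
proof -
  have "Ck_on k UNIV (exp :: real \<Rightarrow> real)" for k
  proof (induction k)
    case 0
    show ?case by (simp add: continuous_on_exp)
  next
    case (Suc k)
    show ?case
    proof (rule Ck_on_SucI)
      show "(exp has_derivative (\<lambda>h. exp x * h)) (at x)" for x :: real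
        using DERIV_exp[of x] by (simp add: has_field_derivative_def)
    qed (intro Ck_on_mult Ck_on_const Suc)
  qed
  then show ?thesis by (simp add: smooth_on_def)
qed

lemmas smooth_intros = smooth_on_const smooth_on_add smooth_on_mult smooth_on_minus
  smooth_on_power smooth_on_sum smooth_on_component_compose[OF smooth_on_ident]
  smooth_on_component_compose[OF smooth_on_exp]

lemma smooth_on_matB: "smooth_on UNIV (\<lambda>V. matB V $ \<alpha>)"
  unfolding matB_def vector_add_component sum_component vector_scaleR_component real_scaleR_def
  by (intro smooth_intros finite)

lemma smooth_on_acou_inv:
  assumes "smooth_on UNIV cs"
  shows "smooth_on UNIV (\<lambda>V. acou_inv cs V $ \<alpha> $ \<beta>)"
  unfolding acou_inv_def vec_lambda_beta
  by (intro smooth_intros smooth_on_matB smooth_on_component_compose[OF assms] finite)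


section \<open>Linear and quadratic expressions in the first derivatives\<close>

lemma linear_in_derivs_deriv: "linear_in_derivs (\<lambda>V D. D $ \<Theta> $ \<alpha>)"
  unfolding linear_in_derivs_def
proof (intro exI conjI allI)
  fix D :: "real^4^7"
  show "D $ \<Theta> $ \<alpha> = (\<Sum>\<alpha>'\<in>UNIV. \<Sum>\<Theta>'\<in>UNIV.
      (\<lambda>V \<alpha>' \<Theta>'. if \<Theta>' = \<Theta> then if \<alpha>' = \<alpha> then 1 else 0 else 0) V \<alpha>' \<Theta>' * D $ \<Theta>' $ \<alpha>')"
    for V :: "real^7"
    by (simp add: if_distrib[of "\<lambda>c. c * _"] cong: if_cong)
qed (rule smooth_on_const)

lemma linear_in_derivs_add:
  assumes "linear_in_derivs M" "linear_in_derivs N"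
  shows "linear_in_derivs (\<lambda>V D. M V D + N V D)"
proof -
  obtain h k where "\<forall>\<alpha> \<Theta>. smooth_on UNIV (\<lambda>V. h V \<alpha> \<Theta>)"
      "\<forall>V D. M V D = (\<Sum>\<alpha>\<in>UNIV. \<Sum>\<Theta>\<in>UNIV. h V \<alpha> \<Theta> * D $ \<Theta> $ \<alpha>)"
      "\<forall>\<alpha> \<Theta>. smooth_on UNIV (\<lambda>V. k V \<alpha> \<Theta>)"
      "\<forall>V D. N V D = (\<Sum>\<alpha>\<in>UNIV. \<Sum>\<Theta>\<in>UNIV. k V \<alpha> \<Theta> * D $ \<Theta> $ \<alpha>)"
    using assms unfolding linear_in_derivs_def by auto
  then show ?thesis unfolding linear_in_derivs_def
    by (intro exI[of _ "\<lambda>V \<alpha> \<Theta>. h V \<alpha> \<Theta> + k V \<alpha> \<Theta>"])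
      (simp add: smooth_on_add distrib_right sum.distrib)
qed

lemma linear_in_derivs_scale:
  assumes s: "smooth_on UNIV s" and "linear_in_derivs N"
  shows "linear_in_derivs (\<lambda>V D. s V * N V D)"
proof -
  obtain h where "\<forall>\<alpha> \<Theta>. smooth_on UNIV (\<lambda>V. h V \<alpha> \<Theta>)"
      "\<forall>V D. N V D = (\<Sum>\<alpha>\<in>UNIV. \<Sum>\<Theta>\<in>UNIV. h V \<alpha> \<Theta> * D $ \<Theta> $ \<alpha>)"
    using assms unfolding linear_in_derivs_def by auto
  then show ?thesis unfolding linear_in_derivs_def
    by (intro exI[of _ "\<lambda>V \<alpha> \<Theta>. s V * h V \<alpha> \<Theta>"])
      (simp add: smooth_on_mult s sum_distrib_left mult.assoc)
qed

lemma linear_in_derivs_minus: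
  "linear_in_derivs N \<Longrightarrow> linear_in_derivs (\<lambda>V D. - N V D)"
  using linear_in_derivs_scale[OF smooth_on_const[of "-1"]] by simp

lemma linear_in_derivs_diff:
  "linear_in_derivs M \<Longrightarrow> linear_in_derivs N \<Longrightarrow> linear_in_derivs (\<lambda>V D. M V D - N V D)"
  using linear_in_derivs_add[OF _ linear_in_derivs_minus] by simp

lemma linear_in_derivs_sum:
  assumes "finite I" "\<And>i. i \<in> I \<Longrightarrow> linear_in_derivs (N i)"
  shows "linear_in_derivs (\<lambda>V D. \<Sum>i\<in>I. N i V D)"
  using assms
proof (induction I rule: finite_induct)
  case empty
  show ?case
    using linear_in_derivs_scale[OF smooth_on_const[of 0] linear_in_derivs_deriv] by simp
next
  case (insert i I)
  then show ?case by (simp add: linear_in_derivs_add)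
qed

definition quadratic :: "nonlinearity \<Rightarrow> bool" where
  "quadratic N \<longleftrightarrow> (\<exists>f. quadratic_in_derivs N f)"

text \<open>
  The product of two linear expressions has the evident coefficients \<open>h\<^sub>\<alpha>\<^sub>\<Theta> k\<^sub>\<beta>\<^sub>\<Gamma>\<close>, which have to be
  symmetrized.  All quadratic terms of the system are built from such products.
\<close>

lemma quadratic_mult:
  assumes "linear_in_derivs M" "linear_in_derivs N"
  shows "quadratic (\<lambda>V D. M V D * N V D)"
proof -
  obtain h where h: "\<And>\<alpha> \<Theta>. smooth_on UNIV (\<lambda>V. h V \<alpha> \<Theta>)"
    and M: "\<And>V D. M V D = (\<Sum>\<alpha>\<in>UNIV. \<Sum>\<Theta>\<in>UNIV. h V \<alpha> \<Theta> * D $ \<Theta> $ \<alpha>)"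
    using assms(1) unfolding linear_in_derivs_def by auto
  obtain k where k: "\<And>\<alpha> \<Theta>. smooth_on UNIV (\<lambda>V. k V \<alpha> \<Theta>)"
    and N: "\<And>V D. N V D = (\<Sum>\<alpha>\<in>UNIV. \<Sum>\<Theta>\<in>UNIV. k V \<alpha> \<Theta> * D $ \<Theta> $ \<alpha>)"
    using assms(2) unfolding linear_in_derivs_def by auto
  define f where "f V \<alpha> \<beta> \<Theta> \<Gamma> = (1/2) * (h V \<alpha> \<Theta> * k V \<beta> \<Gamma> + k V \<alpha> \<Theta> * h V \<beta> \<Gamma>)"
    for V :: "real^7" and \<alpha> \<beta> :: 4 and \<Theta> \<Gamma> :: 7
  have expand: "(\<Sum>\<alpha>\<in>UNIV. \<Sum>\<beta>\<in>UNIV. \<Sum>\<Theta>\<in>UNIV. \<Sum>\<Gamma>\<in>UNIV.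
      (p \<alpha> \<Theta> * q \<beta> \<Gamma>) * D $ \<Theta> $ \<alpha> * D $ \<Gamma> $ \<beta>) =
      (\<Sum>\<alpha>\<in>UNIV. \<Sum>\<Theta>\<in>UNIV. p \<alpha> \<Theta> * D $ \<Theta> $ \<alpha>) * (\<Sum>\<beta>\<in>UNIV. \<Sum>\<Gamma>\<in>UNIV. q \<beta> \<Gamma> * D $ \<Gamma> $ \<beta>)"
    for p q :: "4 \<Rightarrow> 7 \<Rightarrow> real" and D :: "real^4^7"
    unfolding sum_product by (intro sum.cong refl) (simp add: mult_ac)
  have "M V D * N V D = (\<Sum>\<alpha>\<in>UNIV. \<Sum>\<beta>\<in>UNIV. \<Sum>\<Theta>\<in>UNIV. \<Sum>\<Gamma>\<in>UNIV.
      f V \<alpha> \<beta> \<Theta> \<Gamma> * D $ \<Theta> $ \<alpha> * D $ \<Gamma> $ \<beta>)" for V D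
  proof -
    have "(\<Sum>\<alpha>\<in>UNIV. \<Sum>\<beta>\<in>UNIV. \<Sum>\<Theta>\<in>UNIV. \<Sum>\<Gamma>\<in>UNIV. f V \<alpha> \<beta> \<Theta> \<Gamma> * D $ \<Theta> $ \<alpha> * D $ \<Gamma> $ \<beta>) =
       (1/2) * (M V D * N V D + N V D * M V D)"
      unfolding M N expand[symmetric] f_def
      by (simp only: sum_distrib_left distrib_right distrib_left sum.distrib mult.assoc)
    then show ?thesis by simp
  qed
  moreover have "f V \<alpha> \<beta> \<Theta> \<Gamma> = f V \<beta> \<alpha> \<Gamma> \<Theta>" for V \<alpha> \<beta> \<Theta> \<Gamma>
    by (simp add: f_def algebra_simps)
  moreover have "smooth_on UNIV (\<lambda>V. f V \<alpha> \<beta> \<Theta> \<Gamma>)" for \<alpha> \<beta> \<Theta> \<Gamma>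
    unfolding f_def by (intro smooth_intros h k)
  ultimately show ?thesis unfolding quadratic_def quadratic_in_derivs_def by blast
qed

lemma quadratic_add:
  assumes "quadratic M" "quadratic N"
  shows "quadratic (\<lambda>V D. M V D + N V D)"
proof -
  obtain f k where f: "quadratic_in_derivs M f" and k: "quadratic_in_derivs N k"
    using assms unfolding quadratic_def by auto
  have "quadratic_in_derivs (\<lambda>V D. M V D + N V D) (\<lambda>V \<alpha> \<beta> \<Theta> \<Gamma>. f V \<alpha> \<beta> \<Theta> \<Gamma> + k V \<alpha> \<beta> \<Theta> \<Gamma>)"
    using f k unfolding quadratic_in_derivs_def
    by (simp add: smooth_on_add distrib_right sum.distrib)
  then show ?thesis unfolding quadratic_def by blast
qed

lemma quadratic_scale:
  assumes s: "smooth_on UNIV s" and "quadratic N"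
  shows "quadratic (\<lambda>V D. s V * N V D)"
proof -
  obtain f where f: "quadratic_in_derivs N f"
    using assms unfolding quadratic_def by auto
  have "quadratic_in_derivs (\<lambda>V D. s V * N V D) (\<lambda>V \<alpha> \<beta> \<Theta> \<Gamma>. s V * f V \<alpha> \<beta> \<Theta> \<Gamma>)"
    using f unfolding quadratic_in_derivs_def
    by (simp add: smooth_on_mult s sum_distrib_left mult.assoc)
  then show ?thesis unfolding quadratic_def by blast
qed

lemma quadratic_diff: "quadratic M \<Longrightarrow> quadratic N \<Longrightarrow> quadratic (\<lambda>V D. M V D - N V D)"
  using quadratic_add[OF _ quadratic_scale[OF smooth_on_const[of "-1"]]] by simp

lemma quadratic_sum:
  assumes "finite I" "\<And>i. i \<in> I \<Longrightarrow> quadratic (N i)"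
  shows "quadratic (\<lambda>V D. \<Sum>i\<in>I. N i V D)"
  using assms
proof (induction I rule: finite_induct)
  case empty
  show ?case
    using quadratic_scale[OF smooth_on_const[of 0]
        quadratic_mult[OF linear_in_derivs_deriv linear_in_derivs_deriv]] by simp
next
  case (insert i I)
  then show ?case by (simp add: quadratic_add)
qed

lemma quadratic_metric_form:
  assumes "smooth_on UNIV cs"
  shows "quadratic (\<lambda>V D. \<Sum>\<alpha>\<in>UNIV. \<Sum>\<beta>\<in>UNIV. acou_inv cs V $ \<alpha> $ \<beta> * D $ \<Theta> $ \<alpha> * D $ \<Gamma> $ \<beta>)"
  unfolding mult.assoc
  by (intro quadratic_sum quadratic_scale quadratic_mult smooth_on_acou_inv assms
      linear_in_derivs_deriv finite)

lemma quadratic_Q_vel: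
  assumes "smooth_on UNIV cs" "\<And>\<rho>. cs \<rho> > 0"
  shows "quadratic (Q_vel cs i)"
  unfolding Q_vel_def[abs_def]
  by (intro quadratic_scale quadratic_metric_form smooth_intros smooth_on_divide
      smooth_on_component_compose[OF assms(1)]
      smooth_on_component_compose[OF smooth_on_deriv[OF assms(1)]] assms(1))
    (simp add: assms(2) less_imp_neq[THEN not_sym])

lemma quadratic_Q_dens:
  assumes "smooth_on UNIV cs" "\<And>\<rho>. cs \<rho> > 0"
  shows "quadratic (Q_dens cs)"
  unfolding Q_dens_def[abs_def] case_prod_beta
  by (intro quadratic_add quadratic_scale[where s = "\<lambda>V. 2"] quadratic_scale quadratic_sum
      quadratic_diff quadratic_mult quadratic_metric_form linear_in_derivs_deriv finite.intros
      smooth_intros smooth_on_divide smooth_on_component_compose[OF assms(1)]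
      smooth_on_component_compose[OF smooth_on_deriv[OF assms(1)]] assms(1))
    (simp add: assms(2) less_imp_neq[THEN not_sym])

lemma quadratic_P_vort: "quadratic (P_vort i)"
  unfolding P_vort_def[abs_def]
  by (intro quadratic_sum quadratic_scale quadratic_diff quadratic_mult linear_in_derivs_deriv
      finite smooth_on_const)


section \<open>Null frames\<close>

lemma frame_decomposition:
  assumes "null_frame cs V e"
  shows "axis \<alpha> 1 = (\<Sum>A\<in>UNIV. frame_coeff e \<alpha> A *\<^sub>R e A)"
  using theI'[OF frame_coeff_ex1[OF assms]] unfolding frame_coeff_def by blast

text \<open>
  The dual frame: \<open>covec e A\<close> is the covector that is 1 on \<open>e A\<close> and 0 on the other frame vectors,
  so that \<open>X \<bullet> covec e A\<close> is the component of \<open>X\<close> along \<open>e A\<close>.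
\<close>

definition covec :: "(4 \<Rightarrow> real^4) \<Rightarrow> 4 \<Rightarrow> real^4" where
  "covec e A = (\<chi> \<alpha>. frame_coeff e \<alpha> A)"

lemma derivative_in_frame:
  assumes "null_frame cs V e"
  shows "X \<bullet> d = (\<Sum>A\<in>UNIV. (X \<bullet> covec e A) * (e A \<bullet> d))"
proof -
  have "X = (\<Sum>\<alpha>\<in>UNIV. X $ \<alpha> *\<^sub>R axis \<alpha> 1)"
    using basis_expansion[of X] by (simp add: scalar_mult_eq_scaleR)
  also have "\<dots> = (\<Sum>\<alpha>\<in>UNIV. X $ \<alpha> *\<^sub>R (\<Sum>A\<in>UNIV. frame_coeff e \<alpha> A *\<^sub>R e A))"
    using frame_decomposition[OF assms] by simp
  also have "\<dots> = (\<Sum>A\<in>UNIV. (X \<bullet> covec e A) *\<^sub>R e A)"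
    unfolding scaleR_sum_right
    by (subst sum.swap) (simp add: covec_def inner_vec_def scaleR_sum_left)
  finally have "X \<bullet> d = (\<Sum>A\<in>UNIV. (X \<bullet> covec e A) *\<^sub>R e A) \<bullet> d" by simp
  then show ?thesis by (simp add: inner_sum_left)
qed

definition opposite :: "4 \<Rightarrow> 4" where
  "opposite A = (if A = 3 then 4 else 3)"

text \<open>
  Pairing \<open>\<partial>\<^sub>\<alpha> = M\<^sub>\<alpha>\<^sup>A e\<^sub>A\<close> with one null vector of the frame kills all terms except that of the other
  one, and the two have inner product \<open>-2\<close>.
\<close>

lemma frame_coeff_null:
  assumes nf: "null_frame cs V e" and A: "A \<in> {3, 4}"
  shows "frame_coeff e \<alpha> A = - acou_metric cs V (axis \<alpha> 1) (e (opposite A)) / 2"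
proof -
  have comm: "acou_metric cs V X Y = acou_metric cs V Y X" for X Y
    by (simp add: acou_metric_def mult.commute)
  have add: "acou_metric cs V (X + Y) Z = acou_metric cs V X Z + acou_metric cs V Y Z" for X Y Z
    unfolding acou_metric_expand by (simp add: sum.distrib distrib_right)
  have scale: "acou_metric cs V (r *\<^sub>R X) Z = r * acou_metric cs V X Z" for r X Z
    unfolding acou_metric_expand by (simp add: sum_distrib_left mult.assoc)
  have u: "acou_metric cs V (e 4) (e 4) = 0" "acou_metric cs V (e 3) (e 3) = 0" "acou_metric cs V (e 4) (e 3) = -2"
    "acou_metric cs V (e 1) (e 4) = 0" "acou_metric cs V (e 2) (e 4) = 0"
    "acou_metric cs V (e 1) (e 3) = 0" "acou_metric cs V (e 2) (e 3) = 0"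
    "acou_metric cs V (e 3) (e 4) = -2"
    using nf unfolding null_frame_def by (auto simp: comm)
  have "acou_metric cs V (axis \<alpha> 1) Z = (\<Sum>A\<in>UNIV. frame_coeff e \<alpha> A * acou_metric cs V (e A) Z)" for Z
    by (simp only: frame_decomposition[OF nf, of \<alpha>] sum_4 add scale)
  then show ?thesis
    using A unfolding sum_4 opposite_def by (auto simp: u)
qed

text \<open>
  The one-form \<open>g(B, \<cdot>)\<close> is \<open>-dt\<close>, so the components of \<open>B\<close> along the null vectors are
  given by the time components of these.
\<close>

lemma matB_covec:
  assumes "null_frame cs V e" "A \<in> {3, 4}"
  shows "matB V \<bullet> covec e A = e (opposite A) $ 0 / 2"
proof -
  have B: "matB V $ 0 = 1" "matB V $ 1 = V $ 1" "matB V $ 2 = V $ 2" "matB V $ 3 = V $ 3"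
    by (simp_all add: matB_def sum_3 index_maps axis_4)
  define w where "w = 1 / (cs (V $ 0))\<^sup>2"
  show ?thesis
    unfolding inner_vec_def covec_def vec_lambda_beta frame_coeff_null[OF assms] sum_4_from_0
      acou_metric_explicit w_def[symmetric] axis_4 B
    by (simp add: field_simps)
qed

text \<open>
  By \<open>frame_coeff_null\<close>, this quantity is \<open>g(Y, Y) / 4\<close> for the null vector \<open>Y\<close> opposite to \<open>e A\<close>.
\<close>

lemma covec_null:
  assumes nf: "null_frame cs V e" and A: "A \<in> {3, 4}" and c: "cs (V $ 0) \<noteq> 0"
  shows "(\<Sum>\<alpha>\<in>UNIV. \<Sum>\<beta>\<in>UNIV. acou_inv cs V $ \<alpha> $ \<beta> * covec e A $ \<alpha> * covec e A $ \<beta>) = 0"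
proof -
  let ?Y = "e (opposite A)"
  define w where "w = (cs (V $ 0))\<^sup>2"
  have w: "w \<noteq> 0" using c by (simp add: w_def)
  have "(\<Sum>\<alpha>\<in>UNIV. \<Sum>\<beta>\<in>UNIV. acou_inv cs V $ \<alpha> $ \<beta> * covec e A $ \<alpha> * covec e A $ \<beta>)
      = - (matB V \<bullet> covec e A)\<^sup>2 + w * (\<Sum>a\<in>UNIV. (covec e A $ sp a)\<^sup>2)"
    unfolding acou_inv_def w_def[symmetric] vec_lambda_beta inner_vec_def sum_4_from_0 sum_3
      index_maps axis_4
    by (simp add: algebra_simps power2_eq_square)
  also have "\<dots> = acou_metric cs V ?Y ?Y / 4"
    unfolding matB_covec[OF nf A]
    unfolding acou_metric_explicit sum_3 index_maps covec_def vec_lambda_beta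
      frame_coeff_null[OF nf A] axis_4 w_def[symmetric]
    using w by (simp add: field_simps power2_eq_square)
  also have "\<dots> = 0"
    using nf unfolding null_frame_def opposite_def by simp
  finally show ?thesis .
qed

text \<open>
  A null vector with vanishing time component is zero, because \<open>g\<close> is positive definite on
  \<open>dt = 0\<close>; but the null vectors of a frame are not zero.
\<close>

lemma matB_covec_nonzero:
  assumes nf: "null_frame cs V e" and A: "A \<in> {3, 4}" and c: "cs (V $ 0) \<noteq> 0"
  shows "matB V \<bullet> covec e A \<noteq> 0"
proof
  let ?Y = "e (opposite A)"
  assume "matB V \<bullet> covec e A = 0"
  then have Y0: "?Y $ 0 = 0" using matB_covec[OF nf A] by simp
  have "acou_metric cs V ?Y ?Y = 0"
    using nf unfolding null_frame_def opposite_def by simp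
  then have "(?Y $ 1)\<^sup>2 + (?Y $ 2)\<^sup>2 + (?Y $ 3)\<^sup>2 = 0"
    using c unfolding acou_metric_explicit by (simp add: Y0 power2_eq_square)
  then have "?Y $ 1 = 0" "?Y $ 2 = 0" "?Y $ 3 = 0"
    by (smt (verit) zero_le_power2 power2_eq_iff_nonneg zero_eq_power2)+
  with Y0 have "?Y = 0" by (simp add: vec_eq_iff all_4_from_0)
  then have "acou_metric cs V (e 4) (e 3) = 0"
    unfolding opposite_def acou_metric_def by (auto split: if_splits)
  then show False using nf unfolding null_frame_def by simp
qed


section \<open>Diagonal parts and forms without diagonal null terms\<close>

text \<open>
  This is what becomes of the array of first derivatives when, in \<open>\<partial>\<^sub>\<alpha> = M\<^sub>\<alpha>\<^sup>B e\<^sub>B\<close>, only the term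
  with \<open>B = A\<close> is kept.
\<close>

definition frame_restrict :: "(4 \<Rightarrow> real^4) \<Rightarrow> 4 \<Rightarrow> real^4^7 \<Rightarrow> real^4^7" where
  "frame_restrict e A D = (\<chi> \<Theta> \<alpha>. covec e A $ \<alpha> * (e A \<bullet> D $ \<Theta>))"

lemma diag_part_eq_restrict:
  assumes "quadratic_in_derivs N f"
  shows "diag_part f V e A D = N V (frame_restrict e A D)"
  using assms unfolding quadratic_in_derivs_def diag_part_def frame_restrict_def covec_def
  by (simp add: mult_ac)

text \<open>
  The expressions allowed on the right-hand sides in the strong null condition.
\<close>

definition admissible_form :: "(4 \<Rightarrow> real^4) \<Rightarrow> (real^4^7 \<Rightarrow> real) \<Rightarrow> bool" where
  "admissible_form e \<Phi> \<longleftrightarrow>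
     (\<exists>k. (\<forall>\<Theta> \<Gamma>. k 3 3 \<Theta> \<Gamma> = 0 \<and> k 4 4 \<Theta> \<Gamma> = 0) \<and> (\<forall>D. \<Phi> D = frame_form k e D))"

lemma admissible_form_zero: "admissible_form e (\<lambda>D. 0)"
  unfolding admissible_form_def frame_form_def by (intro exI[of _ "\<lambda>A B \<Theta> \<Gamma>. 0"]) simp

lemma admissible_form_add: "admissible_form e \<Phi> \<Longrightarrow> admissible_form e \<Psi> \<Longrightarrow> admissible_form e (\<lambda>D. \<Phi> D + \<Psi> D)"
proof -
  assume "admissible_form e \<Phi>" "admissible_form e \<Psi>"
  then obtain k l where "\<forall>\<Theta> \<Gamma>. k 3 3 \<Theta> \<Gamma> = 0 \<and> k 4 4 \<Theta> \<Gamma> = 0" "\<forall>D. \<Phi> D = frame_form k e D"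
    "\<forall>\<Theta> \<Gamma>. l 3 3 \<Theta> \<Gamma> = 0 \<and> l 4 4 \<Theta> \<Gamma> = 0" "\<forall>D. \<Psi> D = frame_form l e D"
    unfolding admissible_form_def by auto
  then show ?thesis unfolding admissible_form_def
    by (intro exI[of _ "\<lambda>A B \<Theta> \<Gamma>. k A B \<Theta> \<Gamma> + l A B \<Theta> \<Gamma>"])
      (simp add: frame_form_def distrib_right sum.distrib)
qed

lemma admissible_form_scale: "admissible_form e \<Phi> \<Longrightarrow> admissible_form e (\<lambda>D. c * \<Phi> D)"
proof -
  assume "admissible_form e \<Phi>"
  then obtain k where "\<forall>\<Theta> \<Gamma>. k 3 3 \<Theta> \<Gamma> = 0 \<and> k 4 4 \<Theta> \<Gamma> = 0" "\<forall>D. \<Phi> D = frame_form k e D"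
    unfolding admissible_form_def by auto
  then show ?thesis unfolding admissible_form_def
    by (intro exI[of _ "\<lambda>A B \<Theta> \<Gamma>. c * k A B \<Theta> \<Gamma>"])
      (simp add: frame_form_def mult.assoc sum_distrib_left)
qed

lemma admissible_form_diff: "admissible_form e \<Phi> \<Longrightarrow> admissible_form e \<Psi> \<Longrightarrow> admissible_form e (\<lambda>D. \<Phi> D - \<Psi> D)"
  using admissible_form_add[OF _ admissible_form_scale[of e \<Psi> "-1"]] by simp

lemma admissible_form_sum:
  "finite I \<Longrightarrow> (\<And>i. i \<in> I \<Longrightarrow> admissible_form e (\<Phi> i)) \<Longrightarrow> admissible_form e (\<lambda>D. \<Sum>i\<in>I. \<Phi> i D)"
  by (induction I rule: finite_induct) (auto intro: admissible_form_zero admissible_form_add)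

lemma admissible_form_product:
  assumes "A \<noteq> B"
  shows "admissible_form e (\<lambda>D. (e A \<bullet> D $ \<Theta>) * (e B \<bullet> D $ \<Gamma>))"
proof -
  \<comment> \<open>The nesting lets the sums, from the innermost outwards, each eliminate the outermost condition.\<close>
  define k where "k A' B' \<Theta>' \<Gamma>' =
      (if \<Gamma>' = \<Gamma> then if \<Theta>' = \<Theta> then if B' = B then if A' = A then 1 else 0 else 0 else 0 else (0::real))"
    for A' B' :: 4 and \<Theta>' \<Gamma>' :: 7
  have "frame_form k e D = (e A \<bullet> D $ \<Theta>) * (e B \<bullet> D $ \<Gamma>)" for D
    unfolding frame_form_def k_def
    by (simp add: if_distrib[of "\<lambda>c. c * _"] cong: if_cong)
  then show ?thesis using assms unfolding admissible_form_def
    by (intro exI[of _ k]) (auto simp: k_def)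
qed

text \<open>
  The transport equation for the vorticity constrains the first derivatives at a single point.
  Solutions therefore enter only through an algebraic condition on the array \<open>D\<close>, and coefficients
  chosen for all such arrays depend only on \<open>V\<close> and the frame.
\<close>

lemma strong_null_conditionI:
  assumes "quadratic N"
    and "\<And>V e A. null_frame cs V e \<Longrightarrow> A \<in> {3, 4} \<Longrightarrow>
      \<exists>\<Phi>. admissible_form e \<Phi> \<and>
        (\<forall>D. (\<forall>i. matB V \<bullet> D $ vort i = rhs_vort i V D) \<longrightarrow> N V (frame_restrict e A D) = \<Phi> D)"
  shows "strong_null_condition cs N"
proof -
  obtain f where f: "quadratic_in_derivs N f" using assms(1) unfolding quadratic_def by auto
  have transport: "matB (V x) \<bullet> derivs V x $ vort i = rhs_vort i (V x) (derivs V x)"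
    if "euler_solution cs U V" "x \<in> U" for U V x i
    using that unfolding euler_solution_def by (simp add: derivs_def)
  have "\<exists>k. (\<forall>\<Theta> \<Gamma>. k 3 3 \<Theta> \<Gamma> = 0 \<and> k 4 4 \<Theta> \<Gamma> = 0) \<and>
      (\<forall>U V x. euler_solution cs U V \<and> x \<in> U \<and> V x = V0 \<longrightarrow>
        diag_part f (V x) e A (derivs V x) = frame_form k e (derivs V x))"
    if "null_frame cs V0 e" "A \<in> {3, 4}" for V0 e A
    using assms(2)[OF that] transport unfolding admissible_form_def diag_part_eq_restrict[OF f] by metis
  from this[of _ _ 3] this[of _ _ 4] show ?thesis
    unfolding strong_null_condition_def
    by (intro exI[of _ f] conjI f allI impI) (simp, metis)
qed

section \<open>The quadratic terms\<close>

lemma metric_form_restrict: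
  assumes "null_frame cs V e" "A \<in> {3, 4}" "cs (V $ 0) \<noteq> 0"
  shows "(\<Sum>\<alpha>\<in>UNIV. \<Sum>\<beta>\<in>UNIV. acou_inv cs V $ \<alpha> $ \<beta> *
      frame_restrict e A D $ \<Theta> $ \<alpha> * frame_restrict e A D $ \<Gamma> $ \<beta>) = 0"
proof -
  have "(\<Sum>\<alpha>\<in>UNIV. \<Sum>\<beta>\<in>UNIV. acou_inv cs V $ \<alpha> $ \<beta> *
      frame_restrict e A D $ \<Theta> $ \<alpha> * frame_restrict e A D $ \<Gamma> $ \<beta>) =
    (\<Sum>\<alpha>\<in>UNIV. \<Sum>\<beta>\<in>UNIV. acou_inv cs V $ \<alpha> $ \<beta> * covec e A $ \<alpha> * covec e A $ \<beta>) *
      ((e A \<bullet> D $ \<Theta>) * (e A \<bullet> D $ \<Gamma>))"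
    unfolding sum_distrib_right frame_restrict_def by (simp add: mult_ac)
  then show ?thesis using covec_null[of cs V e A] assms by simp
qed

lemma Q_vel_restrict:
  assumes "null_frame cs V e" "A \<in> {3, 4}" "cs (V $ 0) \<noteq> 0"
  shows "Q_vel cs i V (frame_restrict e A D) = 0"
  unfolding Q_vel_def by (simp add: metric_form_restrict[OF assms])

text \<open>
  On arrays of rank one, both products in a summand
  \<open>\<partial>\<^sub>a v\<^sup>a \<partial>\<^sub>b v\<^sup>b - \<partial>\<^sub>a v\<^sup>b \<partial>\<^sub>b v\<^sup>a\<close> become \<open>m\<^sub>a m\<^sub>b (e\<^sub>A v\<^sup>a)(e\<^sub>A v\<^sup>b)\<close>.
\<close>

lemma Q_dens_restrict:
  assumes "null_frame cs V e" "A \<in> {3, 4}" "cs (V $ 0) \<noteq> 0"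
  shows "Q_dens cs V (frame_restrict e A D) = 0"
proof -
  have "(\<Sum>(a, b)\<in>S. frame_restrict e A D $ vel a $ sp a * frame_restrict e A D $ vel b $ sp b
      - frame_restrict e A D $ vel b $ sp a * frame_restrict e A D $ vel a $ sp b) = 0" for S
    by (rule sum.neutral) (auto simp: frame_restrict_def)
  then show ?thesis unfolding Q_dens_def metric_form_restrict[OF assms] by simp
qed

text \<open>
  Let \<open>W\<close> be the spatial vector with components \<open>\<omega>\<^sup>a\<close>, and let \<open>b\<^sup>C\<close>, \<open>s\<^sup>C\<close> be the
  components of \<open>B\<close>, \<open>W\<close> in the frame.  The transport equation reads
  \<open>b\<^sup>C (e\<^sub>C \<omega>\<^sup>j) = s\<^sup>C (e\<^sub>C v\<^sup>j)\<close>, summed over \<open>C\<close>; dividing by \<open>b\<^sup>A\<close> gives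
  \<open>e\<^sub>A \<omega>\<^sup>j = (s\<^sup>A/b\<^sup>A) (e\<^sub>A v\<^sup>j) + R\<^sup>j\<close>, where \<open>R\<^sup>j\<close> only contains \<open>e\<^sub>C\<close>-derivatives with
  \<open>C \<noteq> A\<close>.  The expression \<open>\<Phi>\<close> is what remains of the rank-one value after this substitution.
\<close>

lemma P_vort_restrict:
  assumes nf: "null_frame cs V e" and A: "A \<in> {3, 4}" and c: "cs (V $ 0) \<noteq> 0"
  shows "\<exists>\<Phi>. admissible_form e \<Phi> \<and>
    (\<forall>D. (\<forall>i. matB V \<bullet> D $ vort i = rhs_vort i V D) \<longrightarrow>
      P_vort i V (frame_restrict e A D) = \<Phi> D)"
proof -
  define W where "W = (\<Sum>a\<in>UNIV. V $ vort a *\<^sub>R axis (sp a) (1::real))"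
  define b where "b C = matB V \<bullet> covec e C" for C
  define s where "s C = W \<bullet> covec e C" for C
  define R where "R j D = (\<Sum>C\<in>UNIV - {A}.
      (s C / b A) * (e C \<bullet> D $ vel j) - (b C / b A) * (e C \<bullet> D $ vort j))"
    for j :: 3 and D :: "real^4^7"
  define m where "m a = covec e A $ sp a" for a
  define \<Phi> where "\<Phi> D = (\<Sum>a\<in>UNIV. \<Sum>d\<in>UNIV. eps i a d * (\<Sum>j\<in>UNIV. (m a * m j) *
      (R j D * (e A \<bullet> D $ vel d) - R d D * (e A \<bullet> D $ vel j))))" for D
  have bA: "b A \<noteq> 0"
    unfolding b_def by (rule matB_covec_nonzero[OF nf A c])
  have "admissible_form e (\<lambda>D. R j D * (e A \<bullet> D $ vel d))" for j d
    unfolding R_def sum_distrib_right left_diff_distrib mult.assoc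
    by (intro admissible_form_sum admissible_form_diff admissible_form_scale admissible_form_product) auto
  then have "admissible_form e \<Phi>"
    unfolding \<Phi>_def[abs_def]
    by (intro admissible_form_sum admissible_form_diff admissible_form_scale finite)
  moreover have "P_vort i V (frame_restrict e A D) = \<Phi> D"
    if tr: "\<forall>i. matB V \<bullet> D $ vort i = rhs_vort i V D" for D
  proof -
    have w: "e A \<bullet> D $ vort j = (s A / b A) * (e A \<bullet> D $ vel j) + R j D" for j
    proof -
      have "W \<bullet> D $ vel j = rhs_vort j V D"
        unfolding W_def rhs_vort_def inner_sum_left by (simp add: inner_axis')
      then have "(\<Sum>C\<in>UNIV. b C * (e C \<bullet> D $ vort j)) = (\<Sum>C\<in>UNIV. s C * (e C \<bullet> D $ vel j))"
        using tr derivative_in_frame[OF nf, of "matB V" "D $ vort j"]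
          derivative_in_frame[OF nf, of W "D $ vel j"] by (simp add: b_def s_def)
      then have "b A * (e A \<bullet> D $ vort j) = s A * (e A \<bullet> D $ vel j) +
          (\<Sum>C\<in>UNIV - {A}. s C * (e C \<bullet> D $ vel j) - b C * (e C \<bullet> D $ vort j))"
        by (simp add: sum.remove[of UNIV A] sum_subtractf)
      moreover have "b A * R j D =
          (\<Sum>C\<in>UNIV - {A}. s C * (e C \<bullet> D $ vel j) - b C * (e C \<bullet> D $ vort j))"
        unfolding R_def sum_distrib_left using bA by (simp add: right_diff_distrib)
      ultimately have "b A * (e A \<bullet> D $ vort j) =
          b A * ((s A / b A) * (e A \<bullet> D $ vel j) + R j D)"
        using bA by (simp add: distrib_left)
      then show ?thesis using bA by simp
    qed
    show ?thesis
      \<comment> \<open>The factor \<open>s\<^sup>A/b\<^sup>A\<close> does not depend on the component \<open>j\<close>, so its terms cancel.\<close>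
      unfolding P_vort_def \<Phi>_def frame_restrict_def vec_lambda_beta w m_def sum_subtractf[symmetric]
      by (intro sum.cong refl arg_cong2[where f = "(*)"]) (simp add: algebra_simps)
  qed
  ultimately show ?thesis by blast
qed

theorem theorem2p2:
  fixes cs :: "real \<Rightarrow> real"
  assumes "smooth_on UNIV cs"
    and "\<And>\<rho>. cs \<rho> > 0"
  shows "(\<forall>i. \<exists>T. linear_in_derivs T \<and> (\<forall>V D. rhs_vel cs i V D = T V D + Q_vel cs i V D)) \<and>
    (\<forall>V D. rhs_dens cs V D = Q_dens cs V D) \<and>
    (\<forall>i. linear_in_derivs (rhs_vort i)) \<and>
    linear_in_derivs rhs_div \<and>
    (\<forall>i. \<exists>T. linear_in_derivs T \<and> (\<forall>V D. rhs_curl i V D = T V D + P_vort i V D)) \<and>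
    (\<forall>i. strong_null_condition cs (Q_vel cs i)) \<and>
    strong_null_condition cs (Q_dens cs) \<and>
    (\<forall>i. strong_null_condition cs (P_vort i))"
proof (intro conjI allI)
  have c: "cs \<rho> \<noteq> 0" for \<rho> using assms(2)[of \<rho>] by simp
  note lin = linear_in_derivs_add linear_in_derivs_diff linear_in_derivs_minus
    linear_in_derivs_sum linear_in_derivs_scale linear_in_derivs_deriv
  show "\<exists>T. linear_in_derivs T \<and> (\<forall>V D. rhs_vel cs i V D = T V D + Q_vel cs i V D)" for i
  proof (intro exI conjI allI)
    \<comment> \<open>\<open>B v\<^sup>a\<close> is written in coordinates, which exhibits it as a sum of smooth multiples of derivatives.\<close>
    show "linear_in_derivs (\<lambda>V D. (- (cs (V $ 0))\<^sup>2 * exp (V $ 0)) * curl_vort D i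
        + (2 * exp (V $ 0)) * (\<Sum>a\<in>UNIV. \<Sum>b\<in>UNIV. (eps i a b * V $ vort b) *
            (\<Sum>\<alpha>\<in>UNIV. matB V $ \<alpha> * D $ vel a $ \<alpha>)))"
      unfolding curl_vort_def
      by (intro lin smooth_intros smooth_on_matB smooth_on_component_compose[OF assms(1)] finite)
  qed (simp add: rhs_vel_def inner_vec_def mult_ac)
  show "rhs_dens cs V D = Q_dens cs V D" for V D
    by (rule rhs_dens_def)
  show "linear_in_derivs (rhs_vort i)" for i
    unfolding rhs_vort_def[abs_def] by (intro lin smooth_intros finite)
  show "linear_in_derivs rhs_div"
    unfolding rhs_div_def[abs_def] by (intro lin smooth_intros finite)
  show "\<exists>T. linear_in_derivs T \<and> (\<forall>V D. rhs_curl i V D = T V D + P_vort i V D)" for i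
  proof (intro exI conjI allI)
    show "linear_in_derivs (\<lambda>V D. exp (V $ 0) * (\<Sum>a\<in>UNIV. V $ vort a * D $ vort i $ sp a)
       - (exp (V $ 0) * V $ vort i) * div_vort D)"
      unfolding div_vort_def by (intro lin smooth_intros finite)
  qed (simp add: rhs_curl_def)
  show "strong_null_condition cs (Q_vel cs i)" for i
    using Q_vel_restrict[of cs, OF _ _ c] admissible_form_zero
    by (intro strong_null_conditionI quadratic_Q_vel assms) blast
  show "strong_null_condition cs (Q_dens cs)"
    using Q_dens_restrict[of cs, OF _ _ c] admissible_form_zero
    by (intro strong_null_conditionI quadratic_Q_dens assms) blast
  show "strong_null_condition cs (P_vort i)" for i
    using P_vort_restrict[of cs, OF _ _ c]
    by (intro strong_null_conditionI quadratic_P_vort) blast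
qed

end
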